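(* Let $d\ge1$ and let $f$ be a solution, with $f>0$ and $|f'|<1$, of $$[1-(f')^2]\,d+f f''=(d+1)[1-(f')^2]^{3/2}f$$ that collapses in finite time in the future. Then $f$ is future unstable, in the sense that a generic perturbation of $f$ collapses at a different finite time in the future. However, the family of time translations $\{f_\tau\}_{\tau\in\mathbb{R}}$, $f_\tau(t)=f(t+\tau)$, is stable, in the sense that for every initial data sufficiently close to that of $f$ one can find $\tau_0$ such that the perturbed solution collapses at the same time $T$ as $f_{\tau_0}$, and the difference between the first derivative of the perturbed solution and that of $f_{\tau_0}$ converges to $0$ as $t\nearrow T$.
   Context: The equation expresses that the spherically symmetric time-like hypersurface $\{r=f(t)\}\subset\mathbb{R}^{1,d+1}$ has constant mean curvature $d+1$. Initial data at a time $t_0$ is the pair $(f(t_0),f'(t_0))\in(0,\infty)\times(-1,1)$; a perturbation of $f$ is a solution of the same equation whose data at $t_0$ is close to that of $f$. "Collapses in finite time in the future" means there is a finite $T>t_0$ such that the solution exists on $[t_0,T)$ and $\lim_{t\nearrow T}f(t)=0$; $T$ is the collapse time. *)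

theory Defs
  imports "HOL-Analysis.Analysis"
begin

text \<open>
  A solution on \<open>I\<close> is carried together with its first derivative \<open>f'\<close>. Derivatives are taken
  within \<open>I\<close>, so they are one-sided at an end point belonging to \<open>I\<close>, and the values of \<open>f\<close>
  outside \<open>I\<close> are irrelevant.
\<close>

definition cmc_solution :: "nat \<Rightarrow> real set \<Rightarrow> (real \<Rightarrow> real) \<Rightarrow> (real \<Rightarrow> real) \<Rightarrow> bool" where
  "cmc_solution d I f f' \<longleftrightarrow>
    (\<exists>f''. \<forall>t\<in>I.
      (f has_real_derivative f' t) (at t within I) \<and>
      (f' has_real_derivative f'' t) (at t within I) \<and>
      0 < f t \<and> \<bar>f' t\<bar> < 1 \<and>
      (1 - (f' t)\<^sup>2) * real d + f t * f'' t
        = (real d + 1) * (1 - (f' t)\<^sup>2) powr (3/2) * f t)"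

definition collapses :: "nat \<Rightarrow> real \<Rightarrow> real \<Rightarrow> (real \<Rightarrow> real) \<Rightarrow> (real \<Rightarrow> real) \<Rightarrow> bool" where
  "collapses d t0 T f f' \<longleftrightarrow>
    t0 < T \<and> cmc_solution d {t0..<T} f f' \<and> (f \<longlongrightarrow> 0) (at_left T)"

definition initial_data :: "(real \<times> real) set" where
  "initial_data = {0<..} \<times> {-1<..<1}"

definition collapses_from ::
  "nat \<Rightarrow> real \<Rightarrow> real \<times> real \<Rightarrow> real \<Rightarrow> (real \<Rightarrow> real) \<Rightarrow> (real \<Rightarrow> real) \<Rightarrow> bool" where
  "collapses_from d t0 p T g g' \<longleftrightarrow> (g t0, g' t0) = p \<and> collapses d t0 T g g'"

text \<open>Genericity is topological: the property holds on an open dense subset of \<open>U\<close>.\<close>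

definition generic_in :: "'a::topological_space set \<Rightarrow> ('a \<Rightarrow> bool) \<Rightarrow> bool" where
  "generic_in U P \<longleftrightarrow> (\<exists>G. open G \<and> G \<subseteq> U \<and> U \<subseteq> closure G \<and> (\<forall>p\<in>G. P p))"

end

theory Submission
  imports Defs
begin

text \<open>
  Multiplying the equation by \<open>f ^ (d - 1) * f' / (1 - f'\<^sup>2) powr (3/2)\<close> shows that the energy
  \<open>E = f ^ d * (1 / sqrt (1 - f'\<^sup>2) - f)\<close> is constant along every solution. It is positive along a
  collapsing one: otherwise \<open>f \<ge> 1 / sqrt (1 - f'\<^sup>2) \<ge> 1\<close> at all times. With the energy, the
  velocity can be eliminated. Put \<open>m(x) = x ^ d / (E + x ^ (d + 1))\<close>; then \<open>f'\<^sup>2 + m(f)\<^sup>2 = 1\<close>, and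
  the equation becomes Newton's equation \<open>f'' = - m(f) * m'(f)\<close>. The right-hand side is smooth up to
  and including \<open>f = 0\<close>. So the collapse, singular for the original equation, is an ordinary point
  of the new one: the solution continues through it, and since \<open>m(0) = 0\<close> it crosses \<open>f = 0\<close>
  with velocity exactly \<open>-1\<close>.

  Everything follows from this picture. All collapsing solutions have velocity tending to \<open>-1\<close>
  (\<open>collapse_velocity\<close>), so two solutions that collapse at the same time have asymptotically equal
  velocities, and the translate of \<open>f\<close> by the difference of the collapse times is the
  required one. The collapse time is determined by the data (\<open>collapse_time_unique\<close>). As the
  crossing is transversal, continuous dependence on initial data shows that nearby data lead to
  collapse too, at a nearby time (\<open>collapse_time_continuous\<close>). Hence the data with a collapse time
  other than \<open>T\<close> form an open set near those of \<open>f\<close> (\<open>open_other_collapse_times\<close>). It is dense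
  (\<open>dense_other_collapse_times\<close>), because moving the data along their own trajectory shifts the
  collapse time strictly.

  Existence, uniqueness and continuous dependence come from Picard iteration and a
  Gronwall estimate for a globally Lipschitz field, the state being the triple of energy, radius
  and velocity.
\<close>

section \<open>Integral curves of a globally Lipschitz field\<close>

definition integral_curve_on ::
  "real set \<Rightarrow> ('a::real_normed_vector \<Rightarrow> 'a) \<Rightarrow> (real \<Rightarrow> 'a) \<Rightarrow> bool" where
  "integral_curve_on I F u \<longleftrightarrow> (\<forall>t\<in>I. (u has_vector_derivative F (u t)) (at t within I))"

lemma integral_curve_on_subset:
  "integral_curve_on I F u \<Longrightarrow> J \<subseteq> I \<Longrightarrow> integral_curve_on J F u"
  unfolding integral_curve_on_def by (auto intro: has_vector_derivative_within_subset)

lemma integral_curve_continuous: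
  "integral_curve_on I F u \<Longrightarrow> continuous_on I u"
  unfolding integral_curve_on_def
  by (meson continuous_on_eq_continuous_within has_vector_derivative_continuous)

primrec picard :: "('a::banach \<Rightarrow> 'a) \<Rightarrow> real \<Rightarrow> 'a \<Rightarrow> nat \<Rightarrow> real \<Rightarrow> 'a" where
  "picard F a z 0 = (\<lambda>t. z)"
| "picard F a z (Suc n) = (\<lambda>t. z + integral {a..t} (\<lambda>s. F (picard F a z n s)))"

lemma continuous_on_picard:
  fixes F :: "'a::banach \<Rightarrow> 'a"
  assumes "continuous_on UNIV F"
  shows "continuous_on {a..b} (picard F a z n)"
proof (induction n)
  case (Suc n)
  have "continuous_on {a..b} (\<lambda>s. F (picard F a z n s))"
    using continuous_on_compose2[OF assms Suc] by simp
  then show ?case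
    by (auto intro!: continuous_intros indefinite_integral_continuous_1 integrable_continuous_real)
qed simp

text \<open>
  Integrating the Lipschitz estimate \<open>n\<close> times gives the term of an exponential series. The
  factorial is what makes the iteration converge on an interval of any length, so that no
  continuation argument is needed.
\<close>

lemma picard_increment_bound:
  fixes F :: "'a::banach \<Rightarrow> 'a"
  assumes L: "L-lipschitz_on UNIV F" and "t \<in> {a..b}"
  shows "norm (picard F a z (Suc n) t - picard F a z n t)
    \<le> norm (F z) * (L ^ n * (t - a) ^ Suc n / fact (Suc n))"
  using \<open>t \<in> {a..b}\<close>
proof (induction n arbitrary: t)
  case 0
  then show ?case by simp
next
  case (Suc n)
  let ?P = "picard F a z"
  let ?C = "L * (norm (F z) * (L ^ n / fact (Suc n)))"
  have contF: "continuous_on UNIV F"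
    using L by (rule lipschitz_on_continuous_on)
  have cont: "continuous_on {a..t} (\<lambda>s. F (?P k s))" for k
    using continuous_on_compose2[OF contF continuous_on_picard[OF contF]] by simp
  have primitive: "((\<lambda>s. ?C * (s - a) ^ Suc n) has_integral
      ?C * ((t - a) ^ Suc (Suc n) / real (Suc (Suc n)))
      - ?C * ((a - a) ^ Suc (Suc n) / real (Suc (Suc n)))) {a..t}"
    using Suc.prems
    by (intro fundamental_theorem_of_calculus)
       (auto simp flip: has_real_derivative_iff_has_vector_derivative simp del: power_Suc of_nat_Suc
             intro!: derivative_eq_intros)
  have "norm (?P (Suc (Suc n)) t - ?P (Suc n) t)
      = norm (integral {a..t} (\<lambda>s. F (?P (Suc n) s) - F (?P n s)))"
    using integral_diff[OF integrable_continuous_real[OF cont[of "Suc n"]]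
        integrable_continuous_real[OF cont[of n]]]
    by simp
  also have "\<dots> \<le> integral {a..t} (\<lambda>s. ?C * (s - a) ^ Suc n)"
  proof (rule integral_norm_bound_integral)
    show "(\<lambda>s. F (?P (Suc n) s) - F (?P n s)) integrable_on {a..t}"
      by (intro integrable_diff integrable_continuous_real cont)
    show "(\<lambda>s. ?C * (s - a) ^ Suc n) integrable_on {a..t}"
      using primitive by blast
    fix s assume s: "s \<in> {a..t}"
    have "norm (F (?P (Suc n) s) - F (?P n s)) \<le> L * norm (?P (Suc n) s - ?P n s)"
      using lipschitz_on_normD[OF L] by simp
    also have "\<dots> \<le> L * (norm (F z) * (L ^ n * (s - a) ^ Suc n / fact (Suc n)))"
      using Suc.IH[of s] Suc.prems s lipschitz_on_nonneg[OF L] by (intro mult_left_mono) auto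
    finally show "norm (F (?P (Suc n) s) - F (?P n s)) \<le> ?C * (s - a) ^ Suc n"
      by (simp add: field_simps)
  qed
  also have "\<dots> = norm (F z) * (L ^ Suc n * (t - a) ^ Suc (Suc n) / fact (Suc (Suc n)))"
    unfolding integral_unique[OF primitive] by (simp add: field_simps)
  finally show ?case .
qed

lemma integral_curve_exists:
  fixes F :: "'a::banach \<Rightarrow> 'a"
  assumes L: "L-lipschitz_on UNIV F"
  obtains u where "u a = z" and "integral_curve_on {a..b} F u"
proof -
  let ?P = "picard F a z"
  let ?M = "\<lambda>n. norm (F z) * (b - a) * ((L * (b - a)) ^ n /\<^sub>R fact n)"
  define u where "u t = z + (\<Sum>n. ?P (Suc n) t - ?P n t)" for t
  have contF: "continuous_on UNIV F"
    using L by (rule lipschitz_on_continuous_on)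
  have L0: "L \<ge> 0" using L by (rule lipschitz_on_nonneg)
  have bound: "norm (?P (Suc n) t - ?P n t) \<le> ?M n" if t: "t \<in> {a..b}" for n t
  proof -
    have "norm (?P (Suc n) t - ?P n t) \<le> norm (F z) * (L ^ n * (t - a) ^ Suc n / fact (Suc n))"
      using L t by (rule picard_increment_bound)
    also have "\<dots> \<le> norm (F z) * (L ^ n * (b - a) ^ Suc n / fact n)"
      using t L0
      by (intro mult_left_mono frac_le power_mono fact_mono) (auto intro!: mult_left_mono power_mono)
    also have "\<dots> = ?M n"
      unfolding power_mult_distrib by (simp add: divide_inverse ac_simps)
    finally show ?thesis .
  qed
  have summable: "summable ?M"
    by (intro summable_mult summable_exp_generic)
  have telescope: "(\<Sum>i<n. ?P (Suc i) t - ?P i t) = ?P n t - z" for n t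
    using sum_lessThan_telescope[of "\<lambda>i. ?P i t" n] by simp
  from summable have "uniform_limit {a..b} (\<lambda>n t. \<Sum>i<n. ?P (Suc i) t - ?P i t)
      (\<lambda>t. \<Sum>i. ?P (Suc i) t - ?P i t) sequentially"
    using bound by (intro Weierstrass_m_test) auto
  then have lim: "uniform_limit {a..b} ?P u sequentially"
    using uniform_limit_add[OF uniform_limit_const[of "\<lambda>_. z" "{a..b}"]]
    unfolding u_def telescope by fastforce
  have contu: "continuous_on {a..b} u"
    by (rule uniform_limit_theorem[OF _ lim])
       (auto intro!: always_eventually continuous_on_picard contF)
  have contFu: "continuous_on {a..b} (\<lambda>s. F (u s))"
    using continuous_on_compose2[OF contF contu] by simp
  have eq: "u t = z + integral {a..t} (\<lambda>s. F (u s))" if t: "t \<in> {a..b}" for t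
  proof -
    have "uniform_limit {a..b} (\<lambda>n s. F (?P n s)) (\<lambda>s. F (u s)) sequentially"
      using lipschitz_on_uniformly_continuous[OF L]
      by (auto intro: uniform_limit_compose_uniformly_continuous_on[OF lim]) 
    then have "uniform_limit {a..t} (\<lambda>n s. F (?P n s)) (\<lambda>s. F (u s)) sequentially"
      by (rule uniform_limit_on_subset) (use t in auto)
    moreover have "continuous_on {a..t} (\<lambda>s. F (?P n s))" for n
      using continuous_on_compose2[OF contF continuous_on_picard[OF contF]] by simp
    ultimately obtain I J where I: "\<And>n. ((\<lambda>s. F (?P n s)) has_integral I n) {a..t}"
      and J: "((\<lambda>s. F (u s)) has_integral J) {a..t}" and IJ: "I \<longlonglongrightarrow> J"
      by (rule uniform_limit_integral) auto
    have "(\<lambda>n. ?P (Suc n) t) = (\<lambda>n. z + I n)"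
      using I by (auto simp: integral_unique)
    moreover have "(\<lambda>n. z + I n) \<longlonglongrightarrow> z + J"
      by (intro tendsto_intros IJ)
    moreover have "(\<lambda>n. ?P (Suc n) t) \<longlonglongrightarrow> u t"
      by (rule LIMSEQ_Suc[OF tendsto_uniform_limitI[OF lim t]])
    ultimately show ?thesis
      using J LIMSEQ_unique by (metis integral_unique)
  qed
  have "integral_curve_on {a..b} F u"
    unfolding integral_curve_on_def
  proof
    fix t assume t: "t \<in> {a..b}"
    have "((\<lambda>t. z + integral {a..t} (\<lambda>s. F (u s))) has_vector_derivative F (u t)) (at t within {a..b})"
      using integral_has_vector_derivative[OF contFu t]
      by (auto intro!: derivative_eq_intros)
    then show "(u has_vector_derivative F (u t)) (at t within {a..b})"
      using t eq by (rule has_vector_derivative_transform[rotated 2])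
  qed
  moreover have "?P n a = z" for n
    by (cases n) auto
  then have "u a = z"
    by (simp add: u_def)
  ultimately show ?thesis by (rule that[rotated])
qed

text \<open>
  Gronwall's inequality for an autonomous field: the squared distance of two curves, weighted by
  \<open>exp (- 2 * L * (t - a))\<close>, has non-positive derivative. It gives both uniqueness and
  continuous dependence on the initial value.
\<close>

lemma integral_curves_diverge_at_most_exponentially:
  fixes F :: "'a::real_inner \<Rightarrow> 'a"
  assumes L: "L-lipschitz_on UNIV F"
    and u: "integral_curve_on {a..b} F u" and v: "integral_curve_on {a..b} F v"
    and t: "t \<in> {a..b}"
  shows "norm (u t - v t) \<le> exp (L * (t - a)) * norm (u a - v a)"
proof -
  define w where "w s = u s - v s" for s
  define \<psi> where "\<psi> s = exp (- 2 * L * (s - a)) * (w s \<bullet> w s)" for s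
  have w': "(w has_vector_derivative F (u s) - F (v s)) (at s within {a..t})" if "s \<in> {a..t}" for s
  proof -
    have "{a..t} \<subseteq> {a..b}" using t by simp
    then show ?thesis
      using that integral_curve_on_subset[OF u] integral_curve_on_subset[OF v]
      unfolding w_def integral_curve_on_def by (blast intro: has_vector_derivative_diff)
  qed
  have \<psi>': "(\<psi> has_real_derivative
      exp (- 2 * L * (s - a)) * (2 * (w s \<bullet> (F (u s) - F (v s))) - 2 * L * (w s \<bullet> w s)))
      (at s within {a..t})" if s: "s \<in> {a..t}" for s
  proof -
    have "((\<lambda>s. w s \<bullet> w s) has_vector_derivative
        w s \<bullet> (F (u s) - F (v s)) + (F (u s) - F (v s)) \<bullet> w s) (at s within {a..t})"
      using bounded_bilinear.has_vector_derivative[OF bounded_bilinear_inner w'[OF s] w'[OF s]] .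
    then have *: "((\<lambda>s. w s \<bullet> w s) has_real_derivative
        w s \<bullet> (F (u s) - F (v s)) + (F (u s) - F (v s)) \<bullet> w s) (at s within {a..t})"
      by (simp add: has_real_derivative_iff_has_vector_derivative)
    show ?thesis
      unfolding \<psi>_def
      by (rule derivative_eq_intros * refl)+ (simp add: inner_commute algebra_simps)
  qed
  have "\<psi> t \<le> \<psi> a"
  proof (rule DERIV_nonpos_imp_decreasing_open[where f = \<psi>])
    show "a \<le> t" using t by simp
    show "continuous_on {a..t} \<psi>"
      using \<psi>' by (meson DERIV_continuous continuous_on_eq_continuous_within)
    fix s assume s: "a < s" "s < t"
    have "w s \<bullet> (F (u s) - F (v s)) \<le> norm (w s) * (L * norm (w s))"
      by (rule order_trans[OF norm_cauchy_schwarz mult_left_mono])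
         (use lipschitz_on_normD[OF L] in \<open>auto simp: w_def\<close>)
    also have "\<dots> = L * (w s \<bullet> w s)"
      by (simp add: dot_square_norm power2_eq_square)
    finally have "exp (- 2 * L * (s - a))
        * (2 * (w s \<bullet> (F (u s) - F (v s))) - 2 * L * (w s \<bullet> w s)) \<le> 0"
      by (intro mult_nonneg_nonpos) auto
    moreover have "at s within {a..t} = at s"
      using s by (simp add: at_within_Icc_at)
    ultimately show "\<exists>y. DERIV \<psi> s :> y \<and> y \<le> 0"
      using \<psi>'[of s] s by auto
  qed
  then have "exp (2 * L * (t - a)) * \<psi> t \<le> exp (2 * L * (t - a)) * \<psi> a"
    by simp
  then have "w t \<bullet> w t \<le> exp (2 * L * (t - a)) * (w a \<bullet> w a)"
    by (simp add: \<psi>_def flip: mult.assoc exp_add)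
  also have "\<dots> = (exp (L * (t - a)) * norm (w a))\<^sup>2"
    by (simp add: dot_square_norm power_mult_distrib flip: exp_double)
  finally have "(norm (w t))\<^sup>2 \<le> (exp (L * (t - a)) * norm (w a))\<^sup>2"
    by (simp add: dot_square_norm)
  then show ?thesis
    unfolding w_def by (rule power2_le_imp_le) simp
qed

section \<open>Products of bounded Lipschitz functions\<close>

definition bounded_lipschitz :: "('a::metric_space \<Rightarrow> real) \<Rightarrow> bool" where
  "bounded_lipschitz f \<longleftrightarrow> (\<exists>B. \<forall>x. \<bar>f x\<bar> \<le> B) \<and> (\<exists>L. L-lipschitz_on UNIV f)"

lemma bounded_lipschitz_mult:
  assumes "bounded_lipschitz f" and "bounded_lipschitz g"
  shows "bounded_lipschitz (\<lambda>x. f x * g x)"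
proof -
  obtain A K where A: "\<And>x. \<bar>f x\<bar> \<le> A" and K: "K-lipschitz_on UNIV f"
    using assms(1) by (auto simp: bounded_lipschitz_def)
  obtain B L where B: "\<And>x. \<bar>g x\<bar> \<le> B" and L: "L-lipschitz_on UNIV g"
    using assms(2) by (auto simp: bounded_lipschitz_def)
  have A0: "0 \<le> A" and B0: "0 \<le> B"
    using order_trans[OF abs_ge_zero A] order_trans[OF abs_ge_zero B] .
  have "(A * L + B * K)-lipschitz_on UNIV (\<lambda>x. f x * g x)"
  proof (rule lipschitz_onI)
    fix x y
    have "f x * g x - f y * g y = f x * (g x - g y) + g y * (f x - f y)"
      by (simp add: algebra_simps)
    then have "\<bar>f x * g x - f y * g y\<bar> \<le> \<bar>f x\<bar> * \<bar>g x - g y\<bar> + \<bar>g y\<bar> * \<bar>f x - f y\<bar>"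
      by (metis abs_mult abs_triangle_ineq)
    also have "\<dots> \<le> A * (L * dist x y) + B * (K * dist x y)"
      using lipschitz_onD[OF K, of x y] lipschitz_onD[OF L, of x y] unfolding dist_real_def
      by (intro add_mono mult_mono A B A0 B0) simp_all
    finally show "dist (f x * g x) (f y * g y) \<le> (A * L + B * K) * dist x y"
      by (simp add: dist_real_def algebra_simps)
  qed (use A0 B0 lipschitz_on_nonneg[OF K] lipschitz_on_nonneg[OF L] in simp)
  moreover have "\<bar>f x * g x\<bar> \<le> A * B" for x
    using A B A0 by (simp add: abs_mult mult_mono)
  ultimately show ?thesis
    unfolding bounded_lipschitz_def by blast
qed

lemma bounded_lipschitz_const: "bounded_lipschitz (\<lambda>x. c)"
  unfolding bounded_lipschitz_def using lipschitz_on_constant by blast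

lemma bounded_lipschitz_diff:
  assumes "bounded_lipschitz f" and "bounded_lipschitz g"
  shows "bounded_lipschitz (\<lambda>x. f x - g x)"
proof -
  obtain A K where A: "\<And>x. \<bar>f x\<bar> \<le> A" and K: "K-lipschitz_on UNIV f"
    using assms(1) by (auto simp: bounded_lipschitz_def)
  obtain B L where B: "\<And>x. \<bar>g x\<bar> \<le> B" and L: "L-lipschitz_on UNIV g"
    using assms(2) by (auto simp: bounded_lipschitz_def)
  have "\<bar>f x - g x\<bar> \<le> A + B" for x
    using A[of x] B[of x] by linarith
  then show ?thesis
    unfolding bounded_lipschitz_def using lipschitz_on_diff[OF K L] by blast
qed

section \<open>The energy and the regularised equation\<close>

text \<open>
  In terms of the Lorentz factor \<open>\<gamma> = 1 / sqrt (1 - f'\<^sup>2)\<close> the conserved quantity is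
  \<open>f ^ d * \<gamma> - f ^ (d + 1)\<close>.
\<close>

definition energy :: "nat \<Rightarrow> real \<times> real \<Rightarrow> real" where
  "energy d p = fst p ^ d * (1 / sqrt (1 - (snd p)\<^sup>2) - fst p)"

text \<open>
  On the level set of energy \<open>E\<close> the inverse Lorentz factor \<open>sqrt (1 - f'\<^sup>2)\<close> is the value at
  \<open>f\<close> of \<open>power_ratio d d E\<close>, which for \<open>E > 0\<close> extends smoothly to \<open>f = 0\<close>. The ratios with a
  smaller exponent in the numerator are those that arise from it by differentiation.
\<close>

definition power_ratio :: "nat \<Rightarrow> nat \<Rightarrow> real \<Rightarrow> real \<Rightarrow> real" where
  "power_ratio d k E x = x ^ k / (E + x ^ (d + 1))"

text \<open>
  Eliminating \<open>f'\<close> from the equation by means of the energy turns it into \<open>f'' = force d E f\<close>.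
  The singular term \<open>d * (1 - f'\<^sup>2) / f\<close> has become \<open>d * x ^ (2 * d - 1) / (E + x ^ (d + 1))\<^sup>2\<close>,
  which is regular at \<open>x = 0\<close>; it is written as a product of two power ratios so that its
  boundedness and its Lipschitz property follow from theirs.
\<close>

definition force :: "nat \<Rightarrow> real \<Rightarrow> real \<Rightarrow> real" where
  "force d E x = (real d + 1) * power_ratio d d E x ^ 3
    - real d * (power_ratio d d E x * power_ratio d (d - 1) E x)"

text \<open>
  The energy is carried along as a constant coordinate, so that dependence on it is covered by
  dependence on the initial state. The two cut-offs make the field globally Lipschitz; they
  are inactive along the curves of interest, where \<open>E \<ge> e\<close> and, up to the collapse, \<open>x \<ge> 0\<close>.
\<close>

definition newton_field :: "nat \<Rightarrow> real \<Rightarrow> real \<times> real \<times> real \<Rightarrow> real \<times> real \<times> real" where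
  "newton_field d e = (\<lambda>(E, x, y). (0, y, force d (max e E) (max 0 x)))"

lemma power_ratio_nonneg: "0 < E \<Longrightarrow> 0 \<le> x \<Longrightarrow> 0 \<le> power_ratio d k E x"
  by (simp add: power_ratio_def)

text \<open>
  The numerator is at most \<open>1\<close> for \<open>x \<le> 1\<close>, and is dominated by \<open>x ^ (d + 1)\<close> otherwise. That
  the bound holds for all \<open>x \<ge> 0\<close> spares a cut-off from above.
\<close>

lemma power_ratio_le:
  assumes "0 < e" "e \<le> E" "0 \<le> x" "k \<le> d + 1"
  shows "power_ratio d k E x \<le> 1 + 1 / e"
proof (cases "x \<le> 1")
  case True
  then have "x ^ k / (E + x ^ (d + 1)) \<le> 1 / e"
    using assms by (intro frac_le) (auto simp: power_le_one intro: add_increasing2)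
  then show ?thesis by (simp add: power_ratio_def)
next
  case False
  then have "x ^ k \<le> x ^ (d + 1)"
    using assms by (intro power_increasing) auto
  then have "x ^ k / (E + x ^ (d + 1)) \<le> 1"
    using assms by (subst divide_le_eq_1_pos) (auto intro!: add_pos_nonneg)
  moreover have "0 \<le> 1 / e" using assms by simp
  ultimately show ?thesis unfolding power_ratio_def by linarith
qed

text \<open>
  The power ratios are closed under differentiation, up to products: this is why bounds on them
  alone yield Lipschitz bounds.
\<close>

lemma power_ratio_has_derivative:
  assumes "E + x ^ (d + 1) \<noteq> 0"
  shows "(power_ratio d k E has_real_derivative
    real k * power_ratio d (k - 1) E x
      - (real d + 1) * (power_ratio d k E x * power_ratio d d E x)) (at x within S)"
proof -
  define Q where "Q = E + x ^ (d + 1)"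
  have Q: "Q \<noteq> 0" using assms by (simp add: Q_def)
  have num: "((\<lambda>x. x ^ k) has_real_derivative real k * x ^ (k - 1)) (at x within S)"
    by (auto intro!: derivative_eq_intros)
  have den: "((\<lambda>x. E + x ^ (d + 1)) has_real_derivative (real d + 1) * x ^ d) (at x within S)"
    by (auto intro!: derivative_eq_intros simp del: power_Suc)
  have "((\<lambda>x. x ^ k / (E + x ^ (d + 1))) has_real_derivative
      (real k * x ^ (k - 1) * Q - x ^ k * ((real d + 1) * x ^ d)) / (Q * Q)) (at x within S)"
    using DERIV_divide[OF num den assms] by (simp only: Q_def)
  moreover have "(real k * x ^ (k - 1) * Q - x ^ k * ((real d + 1) * x ^ d)) / (Q * Q)
      = real k * (x ^ (k - 1) / Q) - (real d + 1) * (x ^ k / Q * (x ^ d / Q))"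
    using Q by (simp add: diff_divide_distrib)
  ultimately show ?thesis
    by (simp only: power_ratio_def[abs_def] Q_def)
qed

lemma bounded_lipschitz_power_ratio:
  assumes "0 < e" "k \<le> d + 1"
  shows "bounded_lipschitz (\<lambda>(E, x, y :: real). power_ratio d k (max e E) (max 0 x))"
proof -
  let ?r = "power_ratio d k"
  define C where "C = 1 + 1 / e"
  define K where "K = real k * C + (real d + 1) * (C * C)"
  have C: "0 \<le> C" using assms by (simp add: C_def)
  have K: "0 \<le> K" using C by (simp add: K_def)
  have bnd: "\<bar>power_ratio d j E x\<bar> \<le> C" if "e \<le> E" "0 \<le> x" "j \<le> d + 1" for j E x
    using power_ratio_le[of e E x j d] power_ratio_nonneg[of E x d j] that assms
    by (auto simp: C_def)
  have in_x: "\<bar>?r E x - ?r E x'\<bar> \<le> K * \<bar>x - x'\<bar>" if "e \<le> E" "0 \<le> x" "0 \<le> x'" for E x x'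
    unfolding real_norm_def[symmetric]
  proof (rule field_differentiable_bound)
    show "convex {0::real..}" by (rule convex_real_interval)
    fix z :: real assume z: "z \<in> {0..}"
    then have "0 < E + z ^ (d + 1)"
      using that assms by (intro add_pos_nonneg) auto
    then show "(?r E has_real_derivative real k * power_ratio d (k - 1) E z
        - (real d + 1) * (?r E z * power_ratio d d E z)) (at z within {0..})"
      by (intro power_ratio_has_derivative) simp
    have "\<bar>real k * power_ratio d (k - 1) E z - (real d + 1) * (?r E z * power_ratio d d E z)\<bar>
        \<le> \<bar>real k * power_ratio d (k - 1) E z\<bar> + \<bar>(real d + 1) * (?r E z * power_ratio d d E z)\<bar>"
      by (rule abs_triangle_ineq4)
    also have "\<dots> \<le> K"
      unfolding K_def abs_mult using that z assms C
      by (intro add_mono mult_mono bnd) simp_all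
    finally show "norm (real k * power_ratio d (k - 1) E z
        - (real d + 1) * (?r E z * power_ratio d d E z)) \<le> K"
      by simp
  qed (use that in auto)
  have in_E: "\<bar>?r E x - ?r E' x\<bar> \<le> C / e * \<bar>E - E'\<bar>" if "e \<le> E" "e \<le> E'" "0 \<le> x" for E E' x
  proof -
    have pos: "e \<le> E + x ^ (d + 1)" "e \<le> E' + x ^ (d + 1)"
      using that by (auto intro: add_increasing2)
    define Q Q' where "Q = E + x ^ (d + 1)" and "Q' = E' + x ^ (d + 1)"
    have Q: "0 < Q" "0 < Q'" "e \<le> Q'"
      using pos assms by (auto simp: Q_def Q'_def)
    have "?r E x - ?r E' x = x ^ k / Q * ((Q' - Q) / Q')"
      using Q unfolding power_ratio_def Q_def[symmetric] Q'_def[symmetric] by (simp add: field_simps)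
    also have "Q' - Q = E' - E" by (simp add: Q_def Q'_def)
    also have "x ^ k / Q = ?r E x" by (simp add: power_ratio_def Q_def)
    finally have "\<bar>?r E x - ?r E' x\<bar> = \<bar>?r E x\<bar> * (\<bar>E' - E\<bar> / Q')"
      using Q by (simp only: abs_mult abs_divide abs_of_pos)
    also have "\<dots> \<le> C * (\<bar>E' - E\<bar> / e)"
      using Q assms C that by (intro mult_mono bnd frac_le) auto
    finally show ?thesis by (simp add: abs_minus_commute[of E' E])
  qed
  have "(K + C / e)-lipschitz_on UNIV (\<lambda>(E, x, y :: real). ?r (max e E) (max 0 x))"
  proof (rule lipschitz_onI)
    fix z w :: "real \<times> real \<times> real"
    obtain E x y where z: "z = (E, x, y)" by (cases z)
    obtain E' x' y' where w: "w = (E', x', y')" by (cases w)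
    have "\<bar>E - E'\<bar> \<le> dist z w" "\<bar>x - x'\<bar> \<le> dist z w"
      using dist_fst_le[of z w] dist_fst_le[of "snd z" "snd w"] dist_snd_le[of z w]
      by (auto simp: z w dist_real_def)
    then have E: "\<bar>max e E - max e E'\<bar> \<le> dist z w" and x: "\<bar>max 0 x - max 0 x'\<bar> \<le> dist z w"
      by linarith+
    have "\<bar>?r (max e E) (max 0 x) - ?r (max e E') (max 0 x')\<bar>
        \<le> \<bar>?r (max e E) (max 0 x) - ?r (max e E) (max 0 x')\<bar>
          + \<bar>?r (max e E) (max 0 x') - ?r (max e E') (max 0 x')\<bar>"
      unfolding dist_real_def[symmetric] by (rule dist_triangle)
    also have "\<dots> \<le> K * \<bar>max 0 x - max 0 x'\<bar> + C / e * \<bar>max e E - max e E'\<bar>"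
      by (intro add_mono in_x in_E) auto
    also have "\<dots> \<le> K * dist z w + C / e * dist z w"
      using C assms by (intro add_mono mult_left_mono E x K) simp
    finally show "dist ((\<lambda>(E, x, y :: real). ?r (max e E) (max 0 x)) z)
        ((\<lambda>(E, x, y :: real). ?r (max e E) (max 0 x)) w) \<le> (K + C / e) * dist z w"
      by (simp only: z w prod.case dist_real_def distrib_right)
  qed (use K C assms in simp)
  moreover have "\<bar>case z of (E, x, y :: real) \<Rightarrow> ?r (max e E) (max 0 x)\<bar> \<le> C" for z
    using assms by (cases z) (auto intro!: bnd)
  ultimately show ?thesis
    unfolding bounded_lipschitz_def by blast
qed

lemma newton_field_lipschitz:
  assumes "0 < e"
  obtains L where "L-lipschitz_on UNIV (newton_field d e)"
proof -
  have "bounded_lipschitz (\<lambda>z. case z of (E, x, y :: real) \<Rightarrow> force d (max e E) (max 0 x))"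
    using bounded_lipschitz_power_ratio[OF assms, of d d]
      bounded_lipschitz_power_ratio[OF assms, of "d - 1" d]
    unfolding force_def power3_eq_cube case_prod_unfold
    by (intro bounded_lipschitz_diff bounded_lipschitz_mult bounded_lipschitz_const) auto
  then obtain L where force: "L-lipschitz_on UNIV (\<lambda>z. case z of (E, x, y :: real) \<Rightarrow> force d (max e E) (max 0 x))"
    unfolding bounded_lipschitz_def by blast
  have velocity: "1-lipschitz_on UNIV (\<lambda>z :: real \<times> real \<times> real. snd (snd z))"
    by (rule lipschitz_onI) (auto intro: order_trans[OF dist_snd_le])
  show ?thesis
    using lipschitz_on_Pair[OF lipschitz_on_constant[of UNIV 0] lipschitz_on_Pair[OF velocity force]]
    by (intro that) (simp add: newton_field_def case_prod_unfold)
qed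


lemma powr_three_halves:
  fixes w :: real
  assumes "0 < w"
  shows "w powr (3 / 2) = sqrt w ^ 3"
proof -
  have "w powr (3 / 2) = (w powr (1 / 2)) powr 3"
    by (simp add: powr_powr)
  also have "\<dots> = sqrt w ^ 3"
    using assms by (simp add: powr_half_sqrt)
  finally show ?thesis .
qed

text \<open>
  Rewriting the energy relation as the sphere \<open>y\<^sup>2 + m(x)\<^sup>2 = 1\<close> makes sense also at \<open>x = 0\<close>,
  where \<open>m\<close> vanishes. This forces the speed of light at the collapse.
\<close>

lemma energy_eq_iff:
  assumes "0 < x" "0 < E"
  shows "\<bar>y\<bar> < 1 \<and> energy d (x, y) = E \<longleftrightarrow> y\<^sup>2 + (power_ratio d d E x)\<^sup>2 = 1"
proof -
  define s where "s = sqrt (1 - y\<^sup>2)"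
  have Q: "0 < E + x ^ (d + 1)"
    using assms by (intro add_pos_pos) auto
  have m: "0 < power_ratio d d E x"
    using assms Q by (simp add: power_ratio_def)
  show ?thesis
  proof
    assume L: "\<bar>y\<bar> < 1 \<and> energy d (x, y) = E"
    then have "y\<^sup>2 < 1" by (simp add: abs_square_less_1)
    then have s: "0 < s" "s\<^sup>2 = 1 - y\<^sup>2"
      by (auto simp: s_def)
    have "E + x ^ (d + 1) = x ^ d / s"
      using L by (auto simp: energy_def s_def algebra_simps)
    then have "power_ratio d d E x = s"
      using assms s by (simp add: power_ratio_def)
    then show "y\<^sup>2 + (power_ratio d d E x)\<^sup>2 = 1"
      using s by simp
  next
    assume R: "y\<^sup>2 + (power_ratio d d E x)\<^sup>2 = 1"
    then have "1 - y\<^sup>2 = (power_ratio d d E x)\<^sup>2" by simp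
    then have "s = power_ratio d d E x"
      unfolding s_def using m by simp
    moreover have "y\<^sup>2 < 1"
      using R zero_less_power[OF m, of 2] by linarith
    moreover have "energy d (x, y) = x ^ d / s - x ^ (d + 1)"
      by (simp add: energy_def s_def algebra_simps)
    ultimately show "\<bar>y\<bar> < 1 \<and> energy d (x, y) = E"
      using Q assms by (simp add: abs_square_less_1 power_ratio_def)
  qed
qed

lemma cmc_equation_iff_force:
  assumes "d \<ge> 1" "0 < x" "0 < E" "y\<^sup>2 + (power_ratio d d E x)\<^sup>2 = 1"
  shows "(1 - y\<^sup>2) * real d + x * a = (real d + 1) * (1 - y\<^sup>2) powr (3/2) * x
    \<longleftrightarrow> a = force d E x"
proof -
  let ?m = "power_ratio d d E x"
  have m: "0 < ?m"
    using assms by (simp add: power_ratio_def add_pos_pos)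
  have w: "1 - y\<^sup>2 = ?m\<^sup>2" using assms by simp
  then have powr: "(1 - y\<^sup>2) powr (3/2) = ?m ^ 3"
    using m by (subst powr_three_halves) auto
  have "x * power_ratio d (d - 1) E x = ?m"
    using assms by (cases d) (auto simp: power_ratio_def)
  then have force: "x * force d E x = (real d + 1) * ?m ^ 3 * x - real d * ?m\<^sup>2"
    by (simp add: force_def power2_eq_square algebra_simps)
  have "(1 - y\<^sup>2) * real d + x * a = (real d + 1) * (1 - y\<^sup>2) powr (3/2) * x
      \<longleftrightarrow> x * a = x * force d E x"
    unfolding powr force unfolding w by (simp add: eq_diff_eq ac_simps)
  then show ?thesis using assms by simp
qed

lemma zero_derivative_imp_equal:
  fixes g :: "real \<Rightarrow> real"
  assumes "convex I" and "\<And>t. t \<in> I \<Longrightarrow> (g has_real_derivative 0) (at t within I)"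
    and "s \<in> I" "t \<in> I"
  shows "g s = g t"
proof -
  obtain c where "\<forall>x\<in>I. g x = c"
    using has_field_derivative_zero_constant[OF assms(1,2)] by blast
  then show ?thesis using assms(3,4) by simp
qed

text \<open>
  The derivative of the energy is \<open>f ^ (d - 1) * f' / (1 - f'\<^sup>2) powr (3/2)\<close> times the difference of the
  two sides of the equation.
\<close>

lemma cmc_energy_conserved:
  assumes "d \<ge> 1" and sol: "cmc_solution d I f f'" and "convex I" "t \<in> I" "a \<in> I"
  shows "energy d (f t, f' t) = energy d (f a, f' a)"
proof -
  obtain f'' where f'': "\<And>t. t \<in> I \<Longrightarrow> (f has_real_derivative f' t) (at t within I)"
    "\<And>t. t \<in> I \<Longrightarrow> (f' has_real_derivative f'' t) (at t within I)"
    "\<And>t. t \<in> I \<Longrightarrow> 0 < f t" "\<And>t. t \<in> I \<Longrightarrow> \<bar>f' t\<bar> < 1"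
    "\<And>t. t \<in> I \<Longrightarrow> (1 - (f' t)\<^sup>2) * real d + f t * f'' t
        = (real d + 1) * (1 - (f' t)\<^sup>2) powr (3/2) * f t"
    using sol unfolding cmc_solution_def by blast
  have "((\<lambda>t. energy d (f t, f' t)) has_real_derivative 0) (at t within I)" if t: "t \<in> I" for t
  proof -
    define s where "s = sqrt (1 - (f' t)\<^sup>2)"
    have w: "0 < 1 - (f' t)\<^sup>2"
      using f''(4)[OF t] by (simp add: abs_square_less_1)
    then have s: "0 < s" "s\<^sup>2 = 1 - (f' t)\<^sup>2"
      by (auto simp: s_def)
    have ode: "s\<^sup>2 * real d + f t * f'' t = (real d + 1) * s ^ 3 * f t"
      using f''(5)[OF t] powr_three_halves[OF w] s by (simp add: s_def)
    have "((\<lambda>t. energy d (f t, f' t)) has_real_derivative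
        real d * f t ^ (d - 1) * f' t * (1 / s - f t)
          + f t ^ d * (f' t * f'' t / s ^ 3 - f' t)) (at t within I)"
    proof -
      have "((\<lambda>t. sqrt (1 - (f' t)\<^sup>2)) has_real_derivative - (f' t * f'' t) / s) (at t within I)"
        using w unfolding s_def
        by (auto intro!: derivative_eq_intros f''(2)[OF t] simp: divide_simps)
      from DERIV_inverse_fun[OF this]
      have "((\<lambda>t. 1 / sqrt (1 - (f' t)\<^sup>2)) has_real_derivative f' t * f'' t / s ^ 3) (at t within I)"
        using w s(1) by (simp add: s_def[symmetric] power3_eq_cube divide_inverse ac_simps)
      then show ?thesis
        unfolding energy_def fst_conv snd_conv
        by (intro DERIV_cong[OF DERIV_mult[OF DERIV_power[OF f''(1)[OF t]] DERIV_diff[OF _ f''(1)[OF t]]]])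
           (auto simp: s_def algebra_simps)
    qed
    moreover have "real d * f t ^ (d - 1) * f' t * (1 / s - f t)
          + f t ^ d * (f' t * f'' t / s ^ 3 - f' t)
        = f t ^ (d - 1) * f' t / s ^ 3
          * (s\<^sup>2 * real d + f t * f'' t - (real d + 1) * s ^ 3 * f t)"
      using s(1) \<open>d \<ge> 1\<close> by (cases d) (auto simp: field_simps power2_eq_square power3_eq_cube)
    ultimately show ?thesis
      using ode by simp
  qed
  then show ?thesis
    using assms by (intro zero_derivative_imp_equal[of I "\<lambda>t. energy d (f t, f' t)"])
qed

lemma integral_curve_of_cmc_solution:
  assumes "d \<ge> 1" and sol: "cmc_solution d I f f'" and "convex I" "a \<in> I"
    and E: "E = energy d (f a, f' a)" and "0 < e" "e \<le> E"
  shows "integral_curve_on I (newton_field d e) (\<lambda>t. (E, f t, f' t))"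
  unfolding integral_curve_on_def
proof
  fix t assume t: "t \<in> I"
  obtain f'' where f'': "(f has_real_derivative f' t) (at t within I)"
    "(f' has_real_derivative f'' t) (at t within I)" "0 < f t" "\<bar>f' t\<bar> < 1"
    "(1 - (f' t)\<^sup>2) * real d + f t * f'' t
        = (real d + 1) * (1 - (f' t)\<^sup>2) powr (3/2) * f t"
    using sol t unfolding cmc_solution_def by blast
  have "energy d (f t, f' t) = E"
    using cmc_energy_conserved[OF \<open>d \<ge> 1\<close> sol \<open>convex I\<close> t \<open>a \<in> I\<close>] E by simp
  then have "(f' t)\<^sup>2 + (power_ratio d d E (f t))\<^sup>2 = 1"
    using energy_eq_iff[of "f t" E "f' t" d] f'' assms by auto
  then have "f'' t = force d E (f t)"
    using cmc_equation_iff_force[of d "f t" E "f' t"] f'' assms by auto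
  then show "((\<lambda>t. (E, f t, f' t)) has_vector_derivative newton_field d e (E, f t, f' t))
      (at t within I)"
    using f'' assms
    by (auto simp: newton_field_def max_def has_real_derivative_iff_has_vector_derivative
        intro!: derivative_eq_intros)
qed

lemma newton_curve_components:
  assumes "integral_curve_on I (newton_field d e) u" "t \<in> I"
  shows "((\<lambda>t. fst (u t)) has_real_derivative 0) (at t within I)"
    and "((\<lambda>t. fst (snd (u t))) has_real_derivative snd (snd (u t))) (at t within I)"
    and "((\<lambda>t. snd (snd (u t))) has_real_derivative
      force d (max e (fst (u t))) (max 0 (fst (snd (u t))))) (at t within I)"
proof -
  have u: "(u has_vector_derivative newton_field d e (u t)) (at t within I)"
    using assms by (auto simp: integral_curve_on_def)
  note s = bounded_linear.has_vector_derivative[OF bounded_linear_snd u]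
  show "((\<lambda>t. fst (u t)) has_real_derivative 0) (at t within I)"
    using bounded_linear.has_vector_derivative[OF bounded_linear_fst u]
    by (simp add: has_real_derivative_iff_has_vector_derivative newton_field_def case_prod_unfold)
  show "((\<lambda>t. fst (snd (u t))) has_real_derivative snd (snd (u t))) (at t within I)"
    using bounded_linear.has_vector_derivative[OF bounded_linear_fst s]
    by (simp add: has_real_derivative_iff_has_vector_derivative newton_field_def case_prod_unfold)
  show "((\<lambda>t. snd (snd (u t))) has_real_derivative
      force d (max e (fst (u t))) (max 0 (fst (snd (u t))))) (at t within I)"
    using bounded_linear.has_vector_derivative[OF bounded_linear_snd s]
    by (simp add: has_real_derivative_iff_has_vector_derivative newton_field_def case_prod_unfold)
qed

text \<open>
  Since \<open>m * m' = - force\<close> for \<open>m = power_ratio d d E\<close>, the sphere relation is the conservation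
  of the mechanical energy of Newton's equation. It is valid as long as \<open>x \<ge> 0\<close>, the moment of
  collapse included.
\<close>

lemma newton_curve_first_integral:
  assumes u: "integral_curve_on I (newton_field d e) u" and "convex I" "a \<in> I" "t \<in> I"
    and E: "fst (u a) = E" "0 < e" "e \<le> E"
    and x: "\<And>t. t \<in> I \<Longrightarrow> 0 \<le> fst (snd (u t))"
  shows "fst (u t) = E"
    and "(snd (snd (u t)))\<^sup>2 + (power_ratio d d E (fst (snd (u t))))\<^sup>2
      = (snd (snd (u a)))\<^sup>2 + (power_ratio d d E (fst (snd (u a))))\<^sup>2"
proof -
  note der = newton_curve_components[OF u]
  have const: "fst (u t) = E" if "t \<in> I" for t
    using zero_derivative_imp_equal[OF \<open>convex I\<close> der(1) that \<open>a \<in> I\<close>] E(1) by simp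
  then show "fst (u t) = E" using \<open>t \<in> I\<close> .
  let ?x = "\<lambda>t. fst (snd (u t))" and ?y = "\<lambda>t. snd (snd (u t))"
  have "((\<lambda>t. (?y t)\<^sup>2 + (power_ratio d d E (?x t))\<^sup>2) has_real_derivative 0) (at t within I)"
    if t: "t \<in> I" for t
  proof -
    have "0 < E + ?x t ^ (d + 1)"
      using E x[OF t] by (intro add_pos_nonneg) auto
    then have "((\<lambda>t. power_ratio d d E (?x t)) has_real_derivative
        (real d * power_ratio d (d - 1) E (?x t)
      - (real d + 1) * (power_ratio d d E (?x t) * power_ratio d d E (?x t))) * ?y t) (at t within I)"
      by (intro DERIV_chain2[OF _ der(2)[OF t]] power_ratio_has_derivative) simp
    moreover have "(?y has_real_derivative force d E (?x t)) (at t within I)"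
      using der(3)[OF t] const[OF t] E x[OF t] by (simp add: max_def)
    ultimately show ?thesis
      by (auto intro!: derivative_eq_intros
          simp: force_def power2_eq_square power3_eq_cube algebra_simps)
  qed
  then show "(?y t)\<^sup>2 + (power_ratio d d E (?x t))\<^sup>2 = (?y a)\<^sup>2 + (power_ratio d d E (?x a))\<^sup>2"
    by (rule zero_derivative_imp_equal[OF \<open>convex I\<close> _ \<open>t \<in> I\<close> \<open>a \<in> I\<close>])
qed

section \<open>Passing through the collapse\<close>

lemma initial_data_iff: "(x, y) \<in> initial_data \<longleftrightarrow> 0 < x \<and> \<bar>y\<bar> < 1"
  by (auto simp: initial_data_def)

lemma cmc_solution_subset:
  assumes "cmc_solution d I f f'" "J \<subseteq> I"
  shows "cmc_solution d J f f'"
proof -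
  obtain f'' where "\<forall>t\<in>I. (f has_real_derivative f' t) (at t within I) \<and>
      (f' has_real_derivative f'' t) (at t within I) \<and> 0 < f t \<and> \<bar>f' t\<bar> < 1 \<and>
      (1 - (f' t)\<^sup>2) * real d + f t * f'' t
        = (real d + 1) * (1 - (f' t)\<^sup>2) powr (3/2) * f t"
    using assms(1) unfolding cmc_solution_def by blast
  then show ?thesis
    using assms(2) DERIV_subset unfolding cmc_solution_def by (intro exI[of _ f'']) blast
qed

lemma initial_data_of_cmc_solution:
  "cmc_solution d I f f' \<Longrightarrow> t \<in> I \<Longrightarrow> (f t, f' t) \<in> initial_data"
  by (auto simp: initial_data_iff cmc_solution_def)

lemma eventually_at_left_Ico: "a < b \<Longrightarrow> \<forall>\<^sub>F t in at_left b. t \<in> {a..<b}" for a b :: real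
  by (rule eventually_at_leftI[of a]) auto

text \<open>
  With \<open>E \<le> 0\<close> the radius would be at least the Lorentz factor, hence at least \<open>1\<close> forever.
\<close>

lemma collapse_energy_pos:
  assumes "d \<ge> 1" and col: "collapses d t0 T f f'"
  shows "0 < energy d (f t0, f' t0)"
proof (rule ccontr)
  assume neg: "\<not> 0 < energy d (f t0, f' t0)"
  have T: "t0 < T" and sol: "cmc_solution d {t0..<T} f f'" and lim: "(f \<longlongrightarrow> 0) (at_left T)"
    using col by (auto simp: collapses_def)
  have ge: "1 \<le> f t" if t: "t \<in> {t0..<T}" for t
  proof -
    have "energy d (f t, f' t) \<le> 0"
      using cmc_energy_conserved[OF \<open>d \<ge> 1\<close> sol _ t, of t0] neg T by (simp add: convex_real_interval)
    moreover have data: "0 < f t" "\<bar>f' t\<bar> < 1"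
      using initial_data_of_cmc_solution[OF sol t] by (auto simp: initial_data_iff)
    ultimately have "1 / sqrt (1 - (f' t)\<^sup>2) \<le> f t"
      using zero_less_power[OF data(1), of d] by (auto simp: energy_def mult_le_0_iff)
    moreover have "1 \<le> 1 / sqrt (1 - (f' t)\<^sup>2)"
      using data by (simp add: abs_square_less_1)
    ultimately show ?thesis by simp
  qed
  have "\<forall>\<^sub>F t in at_left T. f t < 1"
    using order_tendstoD(2)[OF lim, of 1] by simp
  then have "\<forall>\<^sub>F t in at_left T. False"
    using eventually_at_left_Ico[OF T] by eventually_elim (use ge in force)
  then show False by (simp add: trivial_limit_at_left_real)
qed

lemma tendsto_at_left_of_continuous_on_Icc:
  fixes u :: "real \<Rightarrow> 'a::topological_space"
  assumes "continuous_on {a..b} u" "a < b"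
  shows "(u \<longlongrightarrow> u b) (at_left b)"
proof -
  have "(u \<longlongrightarrow> u b) (at b within {a..b})"
    using assms unfolding continuous_on_def by auto
  then show ?thesis
    using at_within_Icc_at_left[OF \<open>a < b\<close>] by simp
qed

text \<open>
  The regularised curve agrees with the solution before \<open>T\<close> and reaches \<open>x = 0\<close> at \<open>T\<close> by
  continuity. There \<open>m = 0\<close>, so the velocity is \<open>1\<close> or \<open>-1\<close>, and a positive velocity would
  require negative radii just before \<open>T\<close>.
\<close>

lemma newton_curve_through_collapse:
  assumes "d \<ge> 1" and col: "collapses d t0 T f f'"
    and E: "E = energy d (f t0, f' t0)" "0 < e" "e \<le> E"
    and u: "integral_curve_on {t0..T} (newton_field d e) u" "u t0 = (E, f t0, f' t0)"
  shows "\<And>t. t \<in> {t0..<T} \<Longrightarrow> u t = (E, f t, f' t)" and "u T = (E, 0, -1)"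
proof -
  let ?x = "\<lambda>t. fst (snd (u t))" and ?y = "\<lambda>t. snd (snd (u t))"
  have T: "t0 < T" and sol: "cmc_solution d {t0..<T} f f'" and lim: "(f \<longlongrightarrow> 0) (at_left T)"
    using col by (auto simp: collapses_def)
  obtain L where L: "L-lipschitz_on UNIV (newton_field d e)"
    using newton_field_lipschitz[OF \<open>0 < e\<close>] .
  have f: "integral_curve_on {t0..<T} (newton_field d e) (\<lambda>t. (E, f t, f' t))"
    using T by (intro integral_curve_of_cmc_solution[OF \<open>d \<ge> 1\<close> sol _ _ E]) auto
  show eq: "u t = (E, f t, f' t)" if t: "t \<in> {t0..<T}" for t
  proof -
    have "{t0..t} \<subseteq> {t0..T}" "{t0..t} \<subseteq> {t0..<T}"
      using t by auto
    then show ?thesis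
      using integral_curves_diverge_at_most_exponentially[OF L
          integral_curve_on_subset[OF u(1)] integral_curve_on_subset[OF f], of t0 t t] t u(2)
      by simp
  qed
  have contu: "continuous_on {t0..T} u"
    using u(1) by (rule integral_curve_continuous)
  have "(?x \<longlongrightarrow> ?x T) (at_left T)"
    by (intro tendsto_intros tendsto_at_left_of_continuous_on_Icc[OF contu T])
  moreover have "(?x \<longlongrightarrow> 0) (at_left T)"
    using lim eventually_at_left_Ico[OF T] eq
    by (elim Lim_transform_eventually) (auto elim!: eventually_mono)
  ultimately have xT: "?x T = 0"
    using tendsto_unique trivial_limit_at_left_real by blast
  have xpos: "0 < ?x t" if "t \<in> {t0..<T}" for t
    using eq[OF that] initial_data_of_cmc_solution[OF sol that] by (simp add: initial_data_iff)
  have xnn: "0 \<le> ?x t" if "t \<in> {t0..T}" for t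
    using xpos[of t] xT that by (cases "t = T") auto
  note first_integral = newton_curve_first_integral[OF u(1) _ _ _ _ E(2,3) xnn, of t0 T]
  have ET: "fst (u T) = E"
    using first_integral(1) T u(2) by simp
  have "(f' t0)\<^sup>2 + (power_ratio d d E (f t0))\<^sup>2 = 1"
    using energy_eq_iff[of "f t0" E "f' t0" d] E initial_data_of_cmc_solution[OF sol, of t0] T
    by (auto simp: initial_data_iff)
  then have "(?y T)\<^sup>2 + (power_ratio d d E 0)\<^sup>2 = 1"
    using first_integral(2) T u(2) xT by simp
  then have "(?y T)\<^sup>2 = 1"
    using \<open>d \<ge> 1\<close> by (cases d) (auto simp: power_ratio_def)
  moreover have "?y T \<noteq> 1"
  proof
    assume "?y T = 1"
    then have "(?x has_real_derivative 1) (at T within {t0..T})"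
      using newton_curve_components(2)[OF u(1), of T] T by simp
    then obtain \<delta> where \<delta>: "0 < \<delta>" "\<And>h. 0 < h \<Longrightarrow> T - h \<in> {t0..T} \<Longrightarrow> h < \<delta> \<Longrightarrow> ?x (T - h) < ?x T"
      using has_real_derivative_pos_inc_left[of ?x 1 T "{t0..T}"] by auto
    define h where "h = min (\<delta> / 2) (T - t0)"
    have h: "0 < h" "h < \<delta>" "T - h \<in> {t0..<T}"
      using \<delta>(1) T by (auto simp: h_def min_def)
    then show False
      using \<delta>(2)[of h] xpos[of "T - h"] xT by simp
  qed
  ultimately have "?y T = -1"
    by (simp add: power2_eq_1_iff)
  then show "u T = (E, 0, -1)"
    using ET xT by (metis prod.collapse)
qed

lemma collapse_velocity:
  assumes "d \<ge> 1" and col: "collapses d t0 T f f'"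
  shows "(f' \<longlongrightarrow> -1) (at_left T)"
proof -
  define E where "E = energy d (f t0, f' t0)"
  have T: "t0 < T" using col by (auto simp: collapses_def)
  have E: "0 < E" using collapse_energy_pos[OF assms] by (simp add: E_def)
  obtain L where L: "L-lipschitz_on UNIV (newton_field d E)"
    using newton_field_lipschitz[OF E] .
  obtain u where u: "u t0 = (E, f t0, f' t0)" "integral_curve_on {t0..T} (newton_field d E) u"
    using integral_curve_exists[OF L] .
  note through = newton_curve_through_collapse[OF assms E_def E order_refl u(2,1)]
  have "((\<lambda>t. snd (snd (u t))) \<longlongrightarrow> snd (snd (u T))) (at_left T)"
    by (intro tendsto_intros tendsto_at_left_of_continuous_on_Icc[OF integral_curve_continuous[OF u(2)] T])
  then show ?thesis
    using eventually_at_left_Ico[OF T] unfolding through(2) snd_conv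
    by (elim Lim_transform_eventually) (auto elim!: eventually_mono simp: through(1))
qed

text \<open>
  Both solutions follow the same regularised curve, which is at radius \<open>0\<close> at the earlier of the
  two collapse times, while the other solution still has positive radius there.
\<close>

lemma collapse_time_unique:
  assumes "d \<ge> 1" and "collapses_from d t0 p S g g'" and "collapses_from d t0 p R h h'"
  shows "S = R"
proof -
  have not_less: "\<not> S < R"
    if g: "collapses_from d t0 p S g g'" and h: "collapses_from d t0 p R h h'" for S R g g' h h'
  proof
    assume "S < R"
    define E where "E = energy d (g t0, g' t0)"
    have cg: "collapses d t0 S g g'" and ch: "collapses d t0 R h h'"
      and eq: "g t0 = h t0" "g' t0 = h' t0"
      using g h by (auto simp: collapses_from_def)
    have S: "t0 < S" using cg by (simp add: collapses_def)
    have E: "0 < E" using collapse_energy_pos[OF \<open>d \<ge> 1\<close> cg] by (simp add: E_def)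
    obtain L where L: "L-lipschitz_on UNIV (newton_field d E)"
      using newton_field_lipschitz[OF E] .
    obtain u where u: "u t0 = (E, g t0, g' t0)" "integral_curve_on {t0..R} (newton_field d E) u"
      using integral_curve_exists[OF L] .
    have "integral_curve_on {t0..S} (newton_field d E) u"
      using u(2) \<open>S < R\<close> by (auto elim: integral_curve_on_subset)
    then have "u S = (E, 0, -1)"
      using newton_curve_through_collapse(2)[OF \<open>d \<ge> 1\<close> cg E_def E order_refl] u(1) by simp
    moreover have "u S = (E, h S, h' S)"
      using newton_curve_through_collapse(1)[OF \<open>d \<ge> 1\<close> ch _ E order_refl u(2)] u(1) S \<open>S < R\<close>
      by (simp add: E_def eq)
    moreover have "0 < h S"
      using ch S \<open>S < R\<close> initial_data_of_cmc_solution[of d "{t0..<R}" h h' S]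
      by (simp add: collapses_def initial_data_iff)
    ultimately show False by simp
  qed
  show ?thesis
    using not_less[OF assms(2,3)] not_less[OF assms(3,2)] by simp
qed

text \<open>
  The converse passage: the sphere relation, inherited from the initial data, bounds the speed
  and turns Newton's equation back into the original one.
\<close>

lemma collapses_from_of_newton_curve:
  assumes "d \<ge> 1" and p: "p \<in> initial_data" and E: "E = energy d p" "0 < e" "e \<le> E" and "t0 < S"
    and u: "integral_curve_on {t0..S} (newton_field d e) u" "u t0 = (E, p)"
    and pos: "\<And>t. t \<in> {t0..<S} \<Longrightarrow> 0 < fst (snd (u t))" and zero: "fst (snd (u S)) = 0"
  shows "collapses_from d t0 p S (\<lambda>t. fst (snd (u t))) (\<lambda>t. snd (snd (u t)))"
proof -
  let ?x = "\<lambda>t. fst (snd (u t))" and ?y = "\<lambda>t. snd (snd (u t))"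
  let ?I = "{t0..<S}"
  have uI: "integral_curve_on ?I (newton_field d e) u"
    using u(1) by (rule integral_curve_on_subset) auto
  have E0: "0 < E" using E by simp
  have start: "(snd p)\<^sup>2 + (power_ratio d d E (fst p))\<^sup>2 = 1"
    using energy_eq_iff[OF _ E0, of "fst p" "snd p" d] p E(1) by (cases p) (auto simp: initial_data_iff)
  have "cmc_solution d ?I ?x ?y"
    unfolding cmc_solution_def
  proof (intro exI[of _ "\<lambda>t. force d E (?x t)"] ballI conjI)
    fix t assume t: "t \<in> ?I"
    note der = newton_curve_components[OF uI t]
    note first_integral = newton_curve_first_integral[OF uI _ _ t _ E(2,3), of t0]
    have ft: "fst (u t) = E"
      using first_integral(1) \<open>t0 < S\<close> u(2) pos by (auto simp: less_imp_le)
    have shell: "(?y t)\<^sup>2 + (power_ratio d d E (?x t))\<^sup>2 = 1"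
      using first_integral(2) \<open>t0 < S\<close> u(2) pos start by (auto simp: less_imp_le)
    show "(?x has_real_derivative ?y t) (at t within ?I)" by (rule der(2))
    show "(?y has_real_derivative force d E (?x t)) (at t within ?I)"
      using der(3) ft E pos[OF t] by (simp add: max_def)
    show "0 < ?x t" by (rule pos[OF t])
    show "\<bar>?y t\<bar> < 1"
      using energy_eq_iff[OF pos[OF t] E0] shell by blast
    show "(1 - (?y t)\<^sup>2) * real d + ?x t * force d E (?x t)
        = (real d + 1) * (1 - (?y t)\<^sup>2) powr (3/2) * ?x t"
      using cmc_equation_iff_force[OF \<open>d \<ge> 1\<close> pos[OF t] E0 shell] by blast
  qed
  moreover have "(?x \<longlongrightarrow> ?x S) (at_left S)"
    by (intro tendsto_intros tendsto_at_left_of_continuous_on_Icc[OF integral_curve_continuous[OF u(1)] \<open>t0 < S\<close>])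
  ultimately show ?thesis
    using \<open>t0 < S\<close> u(2) zero by (simp add: collapses_from_def collapses_def)
qed

section \<open>Continuity of the collapse time\<close>

lemma first_zero:
  fixes g :: "real \<Rightarrow> real"
  assumes cont: "continuous_on {a..b} g" and "a \<le> b" "0 < g a" "g b \<le> 0"
  obtains S where "a < S" "S \<le> b" "g S = 0" "\<And>t. t \<in> {a..<S} \<Longrightarrow> 0 < g t"
proof -
  let ?Z = "{t \<in> {a..b}. g t = 0}"
  have "closed ?Z"
    using cont by (intro continuous_closed_preimage_constant) auto
  moreover have "bounded ?Z"
    by (rule bounded_subset[OF bounded_closed_interval[of a b]]) auto
  ultimately have "compact ?Z"
    by (simp add: compact_eq_bounded_closed)
  moreover obtain z where "z \<in> ?Z"
    using IVT2'[OF \<open>g b \<le> 0\<close> _ \<open>a \<le> b\<close> cont] \<open>0 < g a\<close> by auto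
  ultimately obtain S where S: "S \<in> ?Z" "\<And>t. t \<in> ?Z \<Longrightarrow> S \<le> t"
    using compact_attains_inf[of ?Z] by blast
  have "0 < g t" if t: "t \<in> {a..<S}" for t
  proof (rule ccontr)
    assume "\<not> 0 < g t"
    moreover have "continuous_on {a..t} g"
      using cont by (rule continuous_on_subset) (use t S(1) in auto)
    ultimately obtain r where "a \<le> r" "r \<le> t" "g r = 0"
      using IVT2'[of g t 0 a] t \<open>0 < g a\<close> by auto
    then show False using S(2)[of r] S(1) t by auto
  qed
  moreover have "a \<noteq> S" using S(1) \<open>0 < g a\<close> by auto
  ultimately show ?thesis using S(1) by (intro that[of S]) auto
qed

lemma open_initial_data: "open initial_data"
  unfolding initial_data_def by (intro open_Times) auto

lemma isCont_energy:
  assumes "p \<in> initial_data"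
  shows "isCont (energy d) p"
proof -
  have "sqrt (1 - (snd p)\<^sup>2) \<noteq> 0"
    using assms by (cases p) (auto simp: initial_data_iff abs_square_eq_1)
  then show ?thesis
    unfolding energy_def by (intro continuous_intros) auto
qed

text \<open>
  The regularised curve of \<open>f\<close> crosses \<open>x = 0\<close> at \<open>T\<close> with velocity \<open>-1\<close>, hence transversally:
  it is bounded away from \<open>0\<close> up to a time \<open>a\<close> shortly before \<open>T\<close> and negative at a time \<open>b\<close>
  shortly after it. Both properties survive a small uniform perturbation, so the first zero of
  any nearby curve exists and lies between \<open>a\<close> and \<open>b\<close>.
\<close>

lemma collapse_time_continuous:
  assumes "d \<ge> 1" and col: "collapses d t0 T f f'" and "0 < \<epsilon>"
  shows "\<forall>\<^sub>F p in nhds (f t0, f' t0). \<exists>S g g'. \<bar>S - T\<bar> < \<epsilon> \<and> collapses_from d t0 p S g g'"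
proof -
  define p0 where "p0 = (f t0, f' t0)"
  define E where "E = energy d p0"
  define e where "e = E / 2"
  have T: "t0 < T" and sol: "cmc_solution d {t0..<T} f f'"
    using col by (auto simp: collapses_def)
  have p0: "p0 \<in> initial_data"
    using initial_data_of_cmc_solution[OF sol] T by (simp add: p0_def)
  have E: "0 < E"
    using collapse_energy_pos[OF \<open>d \<ge> 1\<close> col] by (simp add: E_def p0_def)
  then have e: "0 < e" "e < E" by (auto simp: e_def)
  obtain L where L: "L-lipschitz_on UNIV (newton_field d e)"
    using newton_field_lipschitz[OF e(1)] .
  obtain u where u: "u t0 = (E, p0)" "integral_curve_on {t0..T + 1} (newton_field d e) u"
    using integral_curve_exists[OF L] .
  let ?x = "\<lambda>t. fst (snd (u t))"
  have "integral_curve_on {t0..T} (newton_field d e) u"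
    using u(2) by (rule integral_curve_on_subset) auto
  note through = newton_curve_through_collapse[OF \<open>d \<ge> 1\<close> col E_def[unfolded p0_def]
      e(1) less_imp_le[OF e(2)] this u(1)[unfolded p0_def]]
  have contx: "continuous_on {t0..T + 1} ?x"
    by (intro continuous_intros integral_curve_continuous[OF u(2)])
  have xpos: "0 < ?x t" if "t \<in> {t0..<T}" for t
    using through(1)[OF that] initial_data_of_cmc_solution[OF sol that] by (simp add: initial_data_iff)
  obtain b where b: "T < b" "b < T + \<epsilon>" "b \<le> T + 1" "?x b < 0"
  proof -
    have "(?x has_real_derivative -1) (at T within {t0..T + 1})"
      using newton_curve_components(2)[OF u(2), of T] T through(2) by simp
    then obtain \<delta> where \<delta>: "0 < \<delta>"
      "\<And>h. 0 < h \<Longrightarrow> T + h \<in> {t0..T + 1} \<Longrightarrow> h < \<delta> \<Longrightarrow> ?x (T + h) < ?x T"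
      using has_real_derivative_neg_dec_right[of ?x "-1" T "{t0..T + 1}"] by auto
    define h where "h = Min {\<delta> / 2, \<epsilon> / 2, 1}"
    have h: "0 < h" "h < \<delta>" "h < \<epsilon>" "h \<le> 1"
      using \<delta>(1) \<open>0 < \<epsilon>\<close> by (auto simp: h_def min_def)
    then show ?thesis
      using that[of "T + h"] \<delta>(2)[of h] T through(2) by simp
  qed
  define a where "a = max t0 (T - \<epsilon> / 2)"
  have a: "t0 \<le> a" "a < T" "T - \<epsilon> < a"
    using T \<open>0 < \<epsilon>\<close> by (auto simp: a_def)
  obtain \<mu> where \<mu>: "0 < \<mu>" "\<And>t. t \<in> {t0..a} \<Longrightarrow> \<mu> \<le> ?x t"
  proof -
    have "continuous_on {t0..a} ?x"
      using contx by (rule continuous_on_subset) (use a in auto)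
    then obtain s where "s \<in> {t0..a}" "\<And>t. t \<in> {t0..a} \<Longrightarrow> ?x s \<le> ?x t"
      using continuous_attains_inf[of "{t0..a}" ?x] a by auto
    then show ?thesis
      using that[of "?x s"] xpos[of s] a by auto
  qed
  \<comment> \<open>A perturbation smaller than \<open>\<delta>\<close> keeps the radius positive up to \<open>a\<close> and negative at \<open>b\<close>.\<close>
  define \<delta> where "\<delta> = min \<mu> (- ?x b)"
  have \<delta>: "0 < \<delta>" using \<mu> b by (simp add: \<delta>_def)
  define C where "C = exp (\<bar>L\<bar> * (T + 1 - t0))"
  have cont: "isCont (energy d) p0"
    using p0 by (rule isCont_energy)
  have "((\<lambda>p. C * norm ((energy d p, p) - (E, p0))) \<longlongrightarrow> C * norm ((energy d p0, p0) - (E, p0)))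
      (nhds p0)"
    using cont by (intro tendsto_intros filterlim_ident) (simp add: isCont_def tendsto_nhds_iff)
  then have "\<forall>\<^sub>F p in nhds p0. C * norm ((energy d p, p) - (E, p0)) < \<delta>"
    using \<delta> by (intro order_tendstoD(2)) (auto simp: E_def)
  moreover have "\<forall>\<^sub>F p in nhds p0. e < energy d p"
    using cont e unfolding E_def by (intro order_tendstoD(1)) (simp_all add: isCont_def tendsto_nhds_iff)
  moreover have "\<forall>\<^sub>F p in nhds p0. p \<in> initial_data"
    using p0 open_initial_data by (rule eventually_nhds_in_open[rotated])
  ultimately have "\<forall>\<^sub>F p in nhds p0. \<exists>S g g'. \<bar>S - T\<bar> < \<epsilon> \<and> collapses_from d t0 p S g g'"
  proof eventually_elim
    case (elim p)
    obtain v where v: "v t0 = (energy d p, p)" "integral_curve_on {t0..T + 1} (newton_field d e) v"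
      using integral_curve_exists[OF L] .
    let ?z = "\<lambda>t. fst (snd (v t))"
    have close: "\<bar>?z t - ?x t\<bar> < \<delta>" if t: "t \<in> {t0..T + 1}" for t
    proof -
      have "\<bar>?z t - ?x t\<bar> \<le> norm (snd (v t - u t))"
        using dist_fst_le[of "snd (v t)" "snd (u t)"] by (simp add: dist_norm)
      also have "\<dots> \<le> norm (v t - u t)"
        using dist_snd_le[of "v t" "u t"] by (simp add: dist_norm)
      also have "\<dots> \<le> exp (L * (t - t0)) * norm (v t0 - u t0)"
        using integral_curves_diverge_at_most_exponentially[OF L v(2) u(2) t] .
      also have "\<dots> \<le> C * norm (v t0 - u t0)"
        unfolding C_def using t
        by (intro mult_right_mono) (auto intro!: mult_mono)
      also have "\<dots> < \<delta>"
        using elim(1) v(1) u(1) by simp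
      finally show ?thesis .
    qed
    have before: "0 < ?z t" if "t \<in> {t0..a}" for t
      using close[of t] \<mu>(2)[OF that] that a by (auto simp: \<delta>_def)
    have "?z b < 0"
      using close[of b] b a by (auto simp: \<delta>_def)
    have curve_b: "integral_curve_on {t0..b} (newton_field d e) v"
      using v(2) by (rule integral_curve_on_subset) (use b in auto)
    have "continuous_on {t0..b} ?z"
      by (intro continuous_intros integral_curve_continuous[OF curve_b])
    then obtain S where S: "t0 < S" "S \<le> b" "?z S = 0" "\<And>t. t \<in> {t0..<S} \<Longrightarrow> 0 < ?z t"
      using first_zero[of t0 b ?z] before[of t0] \<open>?z b < 0\<close> a b by auto
    have "a < S"
      using before[of S] S(1,3) by force
    moreover have "integral_curve_on {t0..S} (newton_field d e) v"
      using curve_b by (rule integral_curve_on_subset) (use S in auto)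
    then have "collapses_from d t0 p S ?z (\<lambda>t. snd (snd (v t)))"
      using collapses_from_of_newton_curve[OF \<open>d \<ge> 1\<close> elim(3) refl e(1) less_imp_le[OF elim(2)] S(1)]
        v(1) S(3,4) by blast
    ultimately show ?case
      using a b S by (intro exI[of _ S] exI conjI) auto
  qed
  then show ?thesis by (simp add: p0_def)
qed

section \<open>Translations in time and instability\<close>

lemma collapses_restart:
  assumes "collapses d t0 T f f'" "t0 \<le> t1" "t1 < T"
  shows "collapses d t1 T f f'"
  using assms cmc_solution_subset[of d "{t0..<T}" f f' "{t1..<T}"] unfolding collapses_def by auto

lemma collapses_translate:
  assumes "collapses d t0 T f f'"
  shows "collapses d (t0 - \<tau>) (T - \<tau>) (\<lambda>t. f (t + \<tau>)) (\<lambda>t. f' (t + \<tau>))"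
proof -
  have T: "t0 < T" and lim: "(f \<longlongrightarrow> 0) (at_left T)"
    using assms by (auto simp: collapses_def)
  obtain f'' where f'': "\<forall>t\<in>{t0..<T}.
      (f has_real_derivative f' t) (at t within {t0..<T}) \<and>
      (f' has_real_derivative f'' t) (at t within {t0..<T}) \<and>
      0 < f t \<and> \<bar>f' t\<bar> < 1 \<and>
      (1 - (f' t)\<^sup>2) * real d + f t * f'' t
        = (real d + 1) * (1 - (f' t)\<^sup>2) powr (3/2) * f t"
    using assms unfolding collapses_def cmc_solution_def by blast
  have shift: "((\<lambda>t. g (t + \<tau>)) has_real_derivative D) (at t within {t0 - \<tau>..<T - \<tau>})"
    if "(g has_real_derivative D) (at (t + \<tau>) within {t0..<T})" for g D t
    using that DERIV_at_within_shift[of g D \<tau> t "{t0 - \<tau>..<T - \<tau>}"] by (simp add: add.commute)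
  have "cmc_solution d {t0 - \<tau>..<T - \<tau>} (\<lambda>t. f (t + \<tau>)) (\<lambda>t. f' (t + \<tau>))"
    unfolding cmc_solution_def
  proof (intro exI[of _ "\<lambda>t. f'' (t + \<tau>)"] ballI)
    fix t assume "t \<in> {t0 - \<tau>..<T - \<tau>}"
    then have "t + \<tau> \<in> {t0..<T}" by auto
    from bspec[OF f'' this] show "((\<lambda>t. f (t + \<tau>)) has_real_derivative f' (t + \<tau>)) (at t within {t0 - \<tau>..<T - \<tau>}) \<and>
      ((\<lambda>t. f' (t + \<tau>)) has_real_derivative f'' (t + \<tau>)) (at t within {t0 - \<tau>..<T - \<tau>}) \<and>
      0 < f (t + \<tau>) \<and> \<bar>f' (t + \<tau>)\<bar> < 1 \<and>
      (1 - (f' (t + \<tau>))\<^sup>2) * real d + f (t + \<tau>) * f'' (t + \<tau>)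
        = (real d + 1) * (1 - (f' (t + \<tau>))\<^sup>2) powr (3/2) * f (t + \<tau>)"
      using shift by blast
  qed
  moreover have "((\<lambda>t. f (t + \<tau>)) \<longlongrightarrow> 0) (at_left (T - \<tau>))"
    unfolding filtermap_at_left_shift[symmetric] filterlim_filtermap using lim by simp
  ultimately show ?thesis using T by (simp add: collapses_def)
qed

text \<open>
  Starting instead from the data that the solution itself has a moment later makes it collapse
  earlier by that moment. Such data approach the original data.
\<close>

lemma in_closure_of_other_collapse_times:
  assumes "d \<ge> 1" and col: "collapses d t0 T g g'" and U: "open U" "(g t0, g' t0) \<in> U"
  shows "(g t0, g' t0) \<in> closure {p \<in> U. \<exists>S h h'. S \<noteq> T \<and> collapses_from d t0 p S h h'}"
    (is "_ \<in> closure ?G")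
proof -
  have T: "t0 < T" and sol: "cmc_solution d {t0..<T} g g'"
    using col by (auto simp: collapses_def)
  define b where "b = (t0 + T) / 2"
  have b: "t0 < b" "{t0..b} \<subseteq> {t0..<T}"
    using T by (auto simp: b_def)
  have "continuous (at t0 within {t0..b}) g" "continuous (at t0 within {t0..b}) g'"
    using cmc_solution_subset[OF sol b(2)] b(1) unfolding cmc_solution_def
    by (auto intro: DERIV_continuous)
  then have lim: "((\<lambda>t. (g t, g' t)) \<longlongrightarrow> (g t0, g' t0)) (at_right t0)"
    using at_within_Icc_at_right[OF b(1)] by (auto simp: continuous_within intro!: tendsto_Pair)
  have "\<forall>\<^sub>F t in at_right t0. t \<in> {t0<..<T}"
    using T by (intro eventually_at_rightI[of t0 T]) auto
  moreover have "\<forall>\<^sub>F t in at_right t0. (g t, g' t) \<in> U"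
    using lim U by (rule topological_tendstoD)
  ultimately have "\<forall>\<^sub>F t in at_right t0. (g t, g' t) \<in> closure ?G"
  proof eventually_elim
    case (elim t)
    have "collapses d t T g g'"
      using collapses_restart[OF col] elim by auto
    from collapses_translate[OF this, of "t - t0"]
    have "collapses_from d t0 (g t, g' t) (T - (t - t0)) (\<lambda>s. g (s + (t - t0))) (\<lambda>s. g' (s + (t - t0)))"
      by (simp add: collapses_from_def)
    moreover have "T - (t - t0) \<noteq> T" using elim by simp
    ultimately have "\<exists>S h h'. S \<noteq> T \<and> collapses_from d t0 (g t, g' t) S h h'"
      by (intro exI conjI)
    then have "(g t, g' t) \<in> ?G" using elim by simp
    then show ?case by (rule subsetD[OF closure_subset])
  qed
  then show ?thesis
    using lim by (intro Lim_in_closed_set[OF closed_closure]) auto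
qed

lemma eventually_collapses:
  assumes "d \<ge> 1" and "collapses d t0 T f f'"
  shows "\<forall>\<^sub>F p in nhds (f t0, f' t0). \<exists>S g g'. collapses_from d t0 p S g g'"
  using collapse_time_continuous[OF assms zero_less_one] by (rule eventually_mono) blast

lemma open_other_collapse_times:
  assumes "d \<ge> 1" and "open U"
  shows "open {p \<in> U. \<exists>S h h'. S \<noteq> T \<and> collapses_from d t0 p S h h'}" (is "open ?G")
proof (subst open_subopen, intro ballI)
  fix p assume "p \<in> ?G"
  then obtain S h h' where p: "p \<in> U" and S: "S \<noteq> T" and h: "collapses_from d t0 p S h h'"
    by auto
  have "\<forall>\<^sub>F q in nhds p. \<exists>R g g'. \<bar>R - S\<bar> < \<bar>S - T\<bar> \<and> collapses_from d t0 q R g g'"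
    using collapse_time_continuous[OF \<open>d \<ge> 1\<close>, of t0 S h h' "\<bar>S - T\<bar>"] h S
    by (auto simp: collapses_from_def)
  moreover have "\<forall>\<^sub>F q in nhds p. q \<in> U"
    using \<open>open U\<close> p by (rule eventually_nhds_in_open)
  ultimately have "\<forall>\<^sub>F q in nhds p. q \<in> ?G"
  proof eventually_elim
    case (elim q)
    then obtain R g g' where R: "\<bar>R - S\<bar> < \<bar>S - T\<bar>" "collapses_from d t0 q R g g'"
      by blast
    have "R \<noteq> T" using R(1) by auto
    then have "\<exists>S h h'. S \<noteq> T \<and> collapses_from d t0 q S h h'"
      using R(2) by (intro exI conjI)
    then show ?case using elim by simp
  qed
  then show "\<exists>V. open V \<and> p \<in> V \<and> V \<subseteq> ?G"
    unfolding eventually_nhds by blast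
qed

lemma dense_other_collapse_times:
  assumes "d \<ge> 1" and "open U" and col: "\<And>p. p \<in> U \<Longrightarrow> \<exists>S g g'. collapses_from d t0 p S g g'"
  shows "U \<subseteq> closure {p \<in> U. \<exists>S h h'. S \<noteq> T \<and> collapses_from d t0 p S h h'}"
proof
  fix p assume p: "p \<in> U"
  then obtain S g g' where g: "collapses_from d t0 p S g g'"
    using col by blast
  show "p \<in> closure {p \<in> U. \<exists>S h h'. S \<noteq> T \<and> collapses_from d t0 p S h h'}"
  proof (cases "S = T")
    case True
    then show ?thesis
      using in_closure_of_other_collapse_times[OF \<open>d \<ge> 1\<close>, of t0 T g g' U] g p \<open>open U\<close>
      by (auto simp: collapses_from_def)
  next
    case False
    then have "\<exists>S h h'. S \<noteq> T \<and> collapses_from d t0 p S h h'"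
      using g by (intro exI conjI)
    then show ?thesis
      using p by (intro subsetD[OF closure_subset]) simp
  qed
qed

lemma initial_data_of_collapses_from:
  assumes "collapses_from d t0 p S g g'"
  shows "p \<in> initial_data"
proof -
  have "(g t0, g' t0) = p" "t0 < S" "cmc_solution d {t0..<S} g g'"
    using assms by (auto simp: collapses_from_def collapses_def)
  then show ?thesis
    using initial_data_of_cmc_solution[of d "{t0..<S}" g g' t0] by auto
qed

lemma generic_data_collapse_at_other_times:
  assumes "d \<ge> 1" and "collapses d t0 T f f'"
  shows "\<exists>U. open U \<and> (f t0, f' t0) \<in> U \<and> U \<subseteq> initial_data \<and>
    generic_in U (\<lambda>p.
      (\<exists>S g g'. collapses_from d t0 p S g g') \<and>
      (\<forall>S g g'. collapses_from d t0 p S g g' \<longrightarrow> S \<noteq> T))"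
proof -
  obtain U where U: "open U" "(f t0, f' t0) \<in> U"
    "\<And>p. p \<in> U \<Longrightarrow> \<exists>S g g'. collapses_from d t0 p S g g'"
    using eventually_collapses[OF assms] unfolding eventually_nhds by blast
  let ?G = "{p \<in> U. \<exists>S h h'. S \<noteq> T \<and> collapses_from d t0 p S h h'}"
  \<comment> \<open>Asking for some collapse time other than \<open>T\<close> is, by uniqueness, asking for all.\<close>
  have "\<forall>S g g'. collapses_from d t0 p S g g' \<longrightarrow> S \<noteq> T" if p: "p \<in> ?G" for p
  proof (intro allI impI)
    fix S g g' assume g: "collapses_from d t0 p S g g'"
    obtain R h h' where "R \<noteq> T" "collapses_from d t0 p R h h'"
      using p by auto
    then show "S \<noteq> T"
      using collapse_time_unique[OF \<open>d \<ge> 1\<close> g] by simp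
  qed
  then have "generic_in U (\<lambda>p. (\<exists>S g g'. collapses_from d t0 p S g g') \<and>
      (\<forall>S g g'. collapses_from d t0 p S g g' \<longrightarrow> S \<noteq> T))"
    unfolding generic_in_def
    using open_other_collapse_times[OF \<open>d \<ge> 1\<close> U(1)] dense_other_collapse_times[OF \<open>d \<ge> 1\<close> U(1,3)] U(3)
    by (intro exI[of _ ?G] conjI ballI) auto
  moreover have "U \<subseteq> initial_data"
    using U(3) initial_data_of_collapses_from by blast
  ultimately show ?thesis
    using U(1,2) by blast
qed

text \<open>
  The translate by the difference of the two collapse times collapses together with the perturbed
  solution, and both velocities then tend to \<open>-1\<close>.
\<close>

lemma time_translations_stable:
  assumes "d \<ge> 1" and "collapses d t0 T f f'"
  shows "\<forall>\<^sub>F p in nhds (f t0, f' t0).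
    (\<exists>S g g'. collapses_from d t0 p S g g') \<and>
    (\<forall>S g g'. collapses_from d t0 p S g g' \<longrightarrow>
      (\<exists>\<tau>0. collapses d (t0 - \<tau>0) S (\<lambda>t. f (t + \<tau>0)) (\<lambda>t. f' (t + \<tau>0)) \<and>
        ((\<lambda>t. g' t - f' (t + \<tau>0)) \<longlongrightarrow> 0) (at_left S)))"
  using eventually_collapses[OF assms]
proof (rule eventually_mono, intro conjI allI impI)
  fix p S g g' assume g: "collapses_from d t0 p S g g'"
  define \<tau> where "\<tau> = T - S"
  have shifted: "collapses d (t0 - \<tau>) S (\<lambda>t. f (t + \<tau>)) (\<lambda>t. f' (t + \<tau>))"
    using collapses_translate[OF assms(2), of \<tau>] by (simp add: \<tau>_def)
  have "(g' \<longlongrightarrow> -1) (at_left S)"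
    using collapse_velocity[OF \<open>d \<ge> 1\<close>] g by (auto simp: collapses_from_def)
  from tendsto_diff[OF this collapse_velocity[OF \<open>d \<ge> 1\<close> shifted]]
  have "((\<lambda>t. g' t - f' (t + \<tau>)) \<longlongrightarrow> 0) (at_left S)" by simp
  with shifted show "\<exists>\<tau>0. collapses d (t0 - \<tau>0) S (\<lambda>t. f (t + \<tau>0)) (\<lambda>t. f' (t + \<tau>0)) \<and>
          ((\<lambda>t. g' t - f' (t + \<tau>0)) \<longlongrightarrow> 0) (at_left S)"
    by blast
qed

theorem theorem2p23:
  fixes d :: nat and t0 T :: real and f f' :: "real \<Rightarrow> real"
  assumes "d \<ge> 1"
    and "collapses d t0 T f f'"
  shows
    "(\<exists>U. open U \<and> (f t0, f' t0) \<in> U \<and> U \<subseteq> initial_data \<and>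
        generic_in U (\<lambda>p.
          (\<exists>S g g'. collapses_from d t0 p S g g') \<and>
          (\<forall>S g g'. collapses_from d t0 p S g g' \<longrightarrow> S \<noteq> T)))
     \<and>
     (\<forall>\<^sub>F p in nhds (f t0, f' t0).
        (\<exists>S g g'. collapses_from d t0 p S g g') \<and>
        (\<forall>S g g'. collapses_from d t0 p S g g' \<longrightarrow>
          (\<exists>\<tau>0. collapses d (t0 - \<tau>0) S (\<lambda>t. f (t + \<tau>0)) (\<lambda>t. f' (t + \<tau>0)) \<and>
            ((\<lambda>t. g' t - f' (t + \<tau>0)) \<longlongrightarrow> 0) (at_left S))))"
  using generic_data_collapse_at_other_times[OF assms] time_translations_stable[OF assms] by (rule conjI)

end
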